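(* Let $\varphi:\mathbb{D}\to\mathbb{D}$ be analytic and let $E_\varphi=\{\zeta\in\mathbb{T}:\varphi\text{ has finite angular derivative at }\zeta\}$. Let $1\le p<\infty$ and $h\in\mathcal{H}^p$. Then: (i) If $W_{h,\varphi}$ is bounded on $\mathcal{H}^p$, then $h$ is bounded on every Stolz domain whose vertex is a point of $E_\varphi$. (ii) If $W_{h,\varphi}$ is compact on $\mathcal{H}^p$, then $h(z)$ tends to zero as $|z|\to 1$ with $z$ in any Stolz domain whose vertex is a point of $E_\varphi$.
   Context: $\mathbb{D}$ is the open unit disc in $\mathbb{C}$ and $\mathbb{T}$ the unit circle. $\mathcal{H}^p$ is the Hardy space of holomorphic $f$ on $\mathbb{D}$ with $\|f\|_p^p=\sup_{0\le r<1}\int_0^{2\pi}|f(re^{i\theta})|^p\,\frac{d\theta}{2\pi}<\infty$. The weighted composition operator is $W_{h,\varphi}f(z)=h(z)f(\varphi(z))$. The map $\varphi$ has finite angular derivative (in the sense of Carathéodory) at $\zeta\in\mathbb{T}$ if there is $\eta\in\mathbb{T}$ such that $(\varphi(z)-\eta)/(z-\zeta)$ has a finite nontangential limit as $z\to\zeta$; by the Julia–Carathéodory theorem this is equivalent to $\liminf_{w\to\zeta}\frac{1-|\varphi(w)|}{1-|w|}<\infty$. A Stolz domain with vertex $\zeta\in\mathbb{T}$ is a nontangential approach region at $\zeta$, e.g. $\{z\in\mathbb{D}:|z-\zeta|<M(1-|z|)\}$ with $M>1$. *)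

theory Defs
  imports "HOL-Complex_Analysis.Complex_Analysis"
begin

text \<open>
  Elements of the Hardy space are represented by functions on all of \<open>\<complex>\<close>; every notion below
  depends only on their values on the open unit disc \<open>ball 0 1\<close>.
\<close>

definition hardy_mean :: "real \<Rightarrow> (complex \<Rightarrow> complex) \<Rightarrow> real \<Rightarrow> real" where
  "hardy_mean p f r =
     integral {0..2*pi} (\<lambda>\<theta>. cmod (f (of_real r * cis \<theta>)) powr p / (2*pi))"

definition hardy_space :: "real \<Rightarrow> (complex \<Rightarrow> complex) set" where
  "hardy_space p =
     {f. f holomorphic_on ball 0 1 \<and> bdd_above (hardy_mean p f ` {0..<1})}"

definition hardy_norm :: "real \<Rightarrow> (complex \<Rightarrow> complex) \<Rightarrow> real" where
  "hardy_norm p f = (SUP r\<in>{0..<1}. hardy_mean p f r) powr (1/p)"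

definition weighted_comp ::
    "(complex \<Rightarrow> complex) \<Rightarrow> (complex \<Rightarrow> complex) \<Rightarrow> (complex \<Rightarrow> complex) \<Rightarrow> complex \<Rightarrow> complex" where
  "weighted_comp h \<phi> f = (\<lambda>z. h z * f (\<phi> z))"

text \<open>
  The next two predicates are meant for linear \<open>T\<close>, such as \<open>weighted_comp h \<phi>\<close>. Both include
  the requirement that \<open>T\<close> maps the Hardy space into itself.
\<close>

definition bounded_on_hardy ::
    "real \<Rightarrow> ((complex \<Rightarrow> complex) \<Rightarrow> complex \<Rightarrow> complex) \<Rightarrow> bool" where
  "bounded_on_hardy p T \<longleftrightarrow>
     (\<forall>f\<in>hardy_space p. T f \<in> hardy_space p) \<and>
     (\<exists>C. \<forall>f\<in>hardy_space p. hardy_norm p (T f) \<le> C * hardy_norm p f)"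

definition compact_on_hardy ::
    "real \<Rightarrow> ((complex \<Rightarrow> complex) \<Rightarrow> complex \<Rightarrow> complex) \<Rightarrow> bool" where
  "compact_on_hardy p T \<longleftrightarrow>
     (\<forall>f\<in>hardy_space p. T f \<in> hardy_space p) \<and>
     (\<forall>F :: nat \<Rightarrow> complex \<Rightarrow> complex.
        (\<forall>n. F n \<in> hardy_space p) \<and> bdd_above (range (\<lambda>n. hardy_norm p (F n))) \<longrightarrow>
        (\<exists>s :: nat \<Rightarrow> nat. \<exists>g\<in>hardy_space p. strict_mono s \<and>
           (\<lambda>n. hardy_norm p (\<lambda>z. T (F (s n)) z - g z)) \<longlonglongrightarrow> 0))"

text \<open>
  Every nontangential approach region at \<open>\<zeta>\<close> is contained, near \<open>\<zeta>\<close>, in one of the following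
  domains with \<open>M > 1\<close>.
\<close>

definition stolz_domain :: "complex \<Rightarrow> real \<Rightarrow> complex set" where
  "stolz_domain \<zeta> M = {z \<in> ball 0 1. cmod (z - \<zeta>) < M * (1 - cmod z)}"

definition has_nontangential_limit ::
    "(complex \<Rightarrow> complex) \<Rightarrow> complex \<Rightarrow> complex \<Rightarrow> bool" where
  "has_nontangential_limit f \<zeta> L \<longleftrightarrow>
     (\<forall>M>1. (f \<longlongrightarrow> L) (at \<zeta> within stolz_domain \<zeta> M))"

definition has_finite_angular_derivative :: "(complex \<Rightarrow> complex) \<Rightarrow> complex \<Rightarrow> bool" where
  "has_finite_angular_derivative \<phi> \<zeta> \<longleftrightarrow>
     (\<exists>\<eta>\<in>sphere 0 1. \<exists>L. has_nontangential_limit (\<lambda>z. (\<phi> z - \<eta>) / (z - \<zeta>)) \<zeta> L)"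

definition angular_derivative_set :: "(complex \<Rightarrow> complex) \<Rightarrow> complex set" where
  "angular_derivative_set \<phi> = {\<zeta>\<in>sphere 0 1. has_finite_angular_derivative \<phi> \<zeta>}"

end

theory Submission
  imports Defs
begin

text \<open>
  The functions \<open>k z = ((1 - \<bar>a\<bar>\<^sup>2) / (1 - cnj a * z)\<^sup>2) powr (1/p)\<close> have norm at most 1, because
  \<open>\<bar>k\<bar> powr p\<close> is a Poisson kernel. Point evaluations satisfy
  \<open>\<bar>f w\<bar> powr p \<le> 4 / (1 - \<bar>w\<bar>) * \<parallel>f\<parallel> powr p\<close>. Applying this to the image of \<open>k\<close> with \<open>a = \<phi> w\<close>
  under the operator bounds \<open>\<bar>h w\<bar> powr p\<close> by a multiple of \<open>(1 - \<bar>\<phi> w\<bar>) / (1 - \<bar>w\<bar>)\<close>, which is bounded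
  on Stolz domains at points with finite angular derivative. In the compact case, \<open>k\<close> tends to 0
  pointwise as \<open>\<bar>a\<bar> \<rightarrow> 1\<close>, so every subsequential limit of the images vanishes.
\<close>

section \<open>The Poisson kernel and its reproducing formula\<close>

lemma hardy_mean_nonneg: "0 \<le> hardy_mean p f r"
proof (cases "(\<lambda>\<theta>. cmod (f (of_real r * cis \<theta>)) powr p / (2*pi)) integrable_on {0..2*pi}")
  case True
  then show ?thesis
    unfolding hardy_mean_def by (rule integral_nonneg) simp
next
  case False
  then show ?thesis
    \<comment> \<open>By convention, the integral of a non-integrable function is 0.\<close>
    unfolding hardy_mean_def by (metis not_integrable_integral order_refl)
qed

text \<open>For \<open>cmod z = 1\<close> the denominator equals |z - w|^2, so this is the usual
  Poisson kernel. The form with \<open>cnj w\<close> is also evaluated inside the disc, where it is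
  |k|^p for the test function k.\<close>

definition poisson_kernel :: "complex \<Rightarrow> complex \<Rightarrow> real" where
  "poisson_kernel w z = (1 - (cmod w)\<^sup>2) / (cmod (1 - cnj w * z))\<^sup>2"

lemma one_minus_cnj_mult_nonzero:
  assumes "cmod w < 1" "cmod z \<le> 1"
  shows "1 - cnj w * z \<noteq> 0"
proof
  assume "1 - cnj w * z = 0"
  then have "cmod (cnj w * z) = 1"
    by (metis eq_iff_diff_eq_0 norm_one)
  moreover have "cmod w * cmod z \<le> cmod w"
    using assms by (simp add: mult_left_le)
  ultimately show False
    using assms by (simp add: norm_mult)
qed

lemma continuous_on_poisson_kernel_cis:
  assumes "cmod w < 1"
  shows "continuous_on S (\<lambda>\<theta>. poisson_kernel w (cis \<theta>))"
  unfolding poisson_kernel_def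
  using one_minus_cnj_mult_nonzero[OF assms]
  by (intro continuous_intros) auto

text \<open>Cauchy's formula at \<open>w\<close> for \<open>F z * (1 - \<bar>w\<bar>\<^sup>2) / (1 - cnj w * z)\<close>.\<close>

lemma poisson_formula:
  assumes cont: "continuous_on (cball 0 1) F" and hol: "F holomorphic_on ball 0 1"
    and w: "cmod w < 1"
  shows "((\<lambda>\<theta>. of_real (poisson_kernel w (cis \<theta>) / (2*pi)) * F (cis \<theta>)) has_integral F w) {0..2*pi}"
proof -
  define G where "G z = F z * of_real (1 - (cmod w)\<^sup>2) / (1 - cnj w * z)" for z
  have nz: "1 - cnj w * z \<noteq> 0" if "cmod z \<le> 1" for z
    using one_minus_cnj_mult_nonzero[OF w that] .
  have w2: "1 - (cmod w)\<^sup>2 > 0"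
    using w by (simp add: power_less_one_iff)
  have ww: "1 - cnj w * w = of_real (1 - (cmod w)\<^sup>2)"
    using complex_norm_square[of w] by (simp add: mult.commute)
  have "G w = F w * of_real (1 - (cmod w)\<^sup>2) / of_real (1 - (cmod w)\<^sup>2)"
    unfolding G_def ww ..
  then have Gw: "G w = F w"
    using w2 by (metis less_irrefl nonzero_mult_div_cancel_right of_real_eq_0_iff)
  have "continuous_on (cball 0 1) G"
    unfolding G_def by (intro continuous_intros cont) (use nz in auto)
  moreover have "G holomorphic_on ball 0 1"
    unfolding G_def by (intro holomorphic_intros hol) (use nz in auto)
  ultimately have "((\<lambda>u. G u / (u - w)) has_contour_integral (2 * of_real pi * \<i> * G w)) (circlepath 0 1)"
    using w by (intro Cauchy_integral_circlepath) auto
  then have "((\<lambda>t. G (cis t) / (cis t - w) * \<i> * cis t) has_integral (2 * of_real pi * \<i> * F w)) {0..2*pi}"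
    using has_contour_integral_part_circlepath_iff[of 0 "2*pi" "\<lambda>u. G u / (u - w)" _ 0 1] Gw
    by (simp add: circlepath_def)
  then have *: "((\<lambda>t. G (cis t) / (cis t - w) * \<i> * cis t * (1 / (2 * of_real pi * \<i>))) has_integral
      (2 * of_real pi * \<i> * F w) * (1 / (2 * of_real pi * \<i>))) {0..2*pi}"
    by (rule has_integral_mult_left)
  \<comment> \<open>On the circle z - w = z * cnj (1 - cnj w * z). Hence z / (z - w) contributes the
    conjugate of the factor 1 / (1 - cnj w * z) already in \<open>G\<close>, and the product is 1 /
    |1 - cnj w * z|^2.\<close>
  have "G (cis t) / (cis t - w) * \<i> * cis t * (1 / (2 * of_real pi * \<i>)) =
      of_real (poisson_kernel w (cis t) / (2*pi)) * F (cis t)" for t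
  proof -
    let ?z = "cis t"
    have zz: "?z * cnj ?z = 1"
      using complex_norm_square[of ?z] by simp
    then have e1: "?z - w = ?z * cnj (1 - cnj w * ?z)"
      by (simp add: algebra_simps)
    have n: "1 - cnj w * ?z \<noteq> 0"
      by (rule nz) simp
    then have "cnj (1 - cnj w * ?z) \<noteq> 0"
      by (metis complex_cnj_zero_iff)
    then have e2: "?z / (?z - w) = 1 / cnj (1 - cnj w * ?z)"
      unfolding e1 by simp
    have e3: "of_real ((cmod (1 - cnj w * ?z))\<^sup>2) = (1 - cnj w * ?z) * cnj (1 - cnj w * ?z)"
      by (rule complex_norm_square)
    have "G ?z / (?z - w) * \<i> * ?z * (1 / (2 * of_real pi * \<i>)) = G ?z * (?z / (?z - w)) / (2 * of_real pi)"
      by simp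
    also have "\<dots> = F ?z * of_real (1 - (cmod w)\<^sup>2) / of_real ((cmod (1 - cnj w * ?z))\<^sup>2) / (2 * of_real pi)"
      unfolding e2 e3 G_def by simp
    also have "\<dots> = of_real (poisson_kernel w ?z / (2*pi)) * F ?z"
      unfolding poisson_kernel_def by simp
    finally show ?thesis .
  qed
  with * show ?thesis by simp
qed

section \<open>Point evaluations on the Hardy space\<close>

text \<open>A rearrangement of t^p >= a^p + p * a^(p-1) * (t - a), solved for t. It is Young's
  inequality with weights 1/p and 1 - 1/p for the numbers t^p * a^(1-p) and a, whose weighted
  geometric mean is t.\<close>

lemma powr_tangent_le:
  fixes a t p :: real
  assumes "1 \<le> p" "0 < a" "0 \<le> t"
  shows "t \<le> a powr (1 - p) / p * t powr p + a * (1 - 1/p)"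
proof (cases "t = 0")
  case True
  with assms show ?thesis by simp
next
  case False
  have "(t powr p * a powr (1 - p)) powr (1/p) * a powr (1 - 1/p) \<le>
      1/p * (t powr p * a powr (1 - p)) + (1 - 1/p) * a"
    using assms False by (intro Youngs_inequality_0) auto
  moreover have "(t powr p * a powr (1 - p)) powr (1/p) * a powr (1 - 1/p) = t"
  proof -
    have "(1 - p) * (1/p) + (1 - 1/p) = 0"
      using assms by (simp add: field_simps)
    then have "a powr ((1 - p) * (1/p)) * a powr (1 - 1/p) = 1"
      using assms by (simp flip: powr_add)
    then show ?thesis
      using assms False by (simp add: powr_mult powr_powr)
  qed
  ultimately show ?thesis by (simp add: mult_ac)
qed

text \<open>
  For \<open>a = \<bar>F w\<bar>\<close>, integrating the tangent inequality for \<open>t \<mapsto> t powr p\<close> at \<open>a\<close> against the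
  Poisson kernel yields Jensen's inequality \<open>a powr p \<le> \<integral> \<bar>F\<bar> powr p\<close>.
\<close>

lemma norm_powr_le_hardy_mean_1:
  assumes cont: "continuous_on (cball 0 1) F" and hol: "F holomorphic_on ball 0 1"
    and w: "cmod w < 1" and p: "1 \<le> p"
  shows "cmod (F w) powr p \<le> 2 / (1 - cmod w) * hardy_mean p F 1"
proof (cases "F w = 0")
  case True
  then show ?thesis using w by (simp add: hardy_mean_nonneg)
next
  case False
  define a where "a = cmod (F w)"
  define c where "c = a powr (1 - p) / p"
  define P where "P \<theta> = poisson_kernel w (cis \<theta>) / (2*pi)" for \<theta>
  define I where "I = integral {0..2*pi} (\<lambda>\<theta>. P \<theta> * cmod (F (cis \<theta>)) powr p)"
  have a: "a > 0" and c: "c > 0"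
    using False p by (auto simp: a_def c_def)
  have w2: "1 - (cmod w)\<^sup>2 > 0"
    using w by (simp add: power_less_one_iff)
  have P0: "P \<theta> \<ge> 0" for \<theta>
    using w2 by (auto simp: P_def poisson_kernel_def)
  have contP: "continuous_on {0..2*pi} P"
    unfolding P_def by (intro continuous_intros continuous_on_poisson_kernel_cis w) auto
  have contF: "continuous_on {0..2*pi} (\<lambda>\<theta>. F (cis \<theta>))"
    by (rule continuous_on_compose2[OF cont]) (auto intro!: continuous_intros)
  have contFp: "continuous_on {0..2*pi} (\<lambda>\<theta>. cmod (F (cis \<theta>)) powr p)"
    by (rule continuous_on_powr') (use p in \<open>auto intro!: continuous_intros contF\<close>)
  \<comment> \<open>The Poisson formula for the constant function 1 shows that the kernel has total
    mass 1; taking real parts makes this a real integral.\<close>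
  have "((\<lambda>\<theta>. of_real (P \<theta>) :: complex) has_integral 1) {0..2*pi}"
    using poisson_formula[of "\<lambda>_. 1" w] w by (simp add: P_def)
  from has_integral_linear[OF this bounded_linear_Re]
  have P1: "(P has_integral 1) {0..2*pi}"
    by (simp add: o_def)
  have IFp: "((\<lambda>\<theta>. P \<theta> * cmod (F (cis \<theta>)) powr p) has_integral I) {0..2*pi}"
    unfolding I_def
    by (intro integrable_integral integrable_continuous_real continuous_intros contP contFp)
  have Fw: "((\<lambda>\<theta>. of_real (P \<theta>) * F (cis \<theta>)) has_integral F w) {0..2*pi}"
    unfolding P_def by (rule poisson_formula[OF cont hol w])
  have R: "((\<lambda>\<theta>. c * (P \<theta> * cmod (F (cis \<theta>)) powr p) + a * (1 - 1/p) * P \<theta>) has_integral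
      c * I + a * (1 - 1/p) * 1) {0..2*pi}"
    by (intro has_integral_add has_integral_mult_right IFp P1)
  have "norm (F w) \<le> c * I + a * (1 - 1/p) * 1"
  proof -
    have "norm (of_real (P \<theta>) * F (cis \<theta>)) \<le> c * (P \<theta> * cmod (F (cis \<theta>)) powr p) + a * (1 - 1/p) * P \<theta>" for \<theta>
      using mult_left_mono[OF powr_tangent_le[OF p a norm_ge_zero[of "F (cis \<theta>)"]] P0[of \<theta>]] P0[of \<theta>]
      by (simp add: norm_mult c_def algebra_simps)
    then have "norm (integral {0..2*pi} (\<lambda>\<theta>. of_real (P \<theta>) * F (cis \<theta>))) \<le>
      integral {0..2*pi} (\<lambda>\<theta>. c * (P \<theta> * cmod (F (cis \<theta>)) powr p) + a * (1 - 1/p) * P \<theta>)"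
      using Fw R by (intro integral_norm_bound_integral) auto
    then show ?thesis
      using integral_unique[OF Fw] integral_unique[OF R] by simp
  qed
  \<comment> \<open>The left side is a itself, so the term a * (1 - 1/p) is absorbed and a / p
    remains.\<close>
  then have "a / p \<le> a powr (1 - p) / p * I"
    unfolding c_def a_def[symmetric] by (simp add: algebra_simps)
  then have "a \<le> a powr (1 - p) * I"
    using p by (simp add: field_simps)
  then have "a powr (p - 1) * a \<le> a powr (p - 1) * (a powr (1 - p) * I)"
    by (rule mult_left_mono) simp
  also have "\<dots> = I"
    using a by (simp flip: powr_add mult.assoc)
  also have "a powr (p - 1) * a = a powr p"
    using a powr_add[of a "p - 1" 1] by simp
  finally have "a powr p \<le> I" .
  also have "I \<le> integral {0..2*pi} (\<lambda>\<theta>. 2 / (1 - cmod w) * (cmod (F (cis \<theta>)) powr p / (2*pi)))"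
    unfolding I_def
  proof (rule integral_le)
    fix \<theta>
    \<comment> \<open>The kernel is at most (1 + |w|) / (1 - |w|) on the circle, which is where the
      factor 2 / (1 - |w|) comes from.\<close>
    have "1 - cmod w \<le> cmod (1 - cnj w * cis \<theta>)"
      using norm_triangle_ineq2[of 1 "cnj w * cis \<theta>"] by (simp add: norm_mult)
    then have "(1 - cmod w)\<^sup>2 \<le> (cmod (1 - cnj w * cis \<theta>))\<^sup>2"
      using w by (intro power_mono) auto
    then have "poisson_kernel w (cis \<theta>) \<le> (1 - (cmod w)\<^sup>2) / (1 - cmod w)\<^sup>2"
      unfolding poisson_kernel_def using w w2 by (intro divide_left_mono mult_pos_pos) (auto simp: zero_less_power2 one_minus_cnj_mult_nonzero)
    also have "\<dots> = (1 + cmod w) / (1 - cmod w)"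
      using w by (simp add: power2_eq_square divide_simps) (simp add: algebra_simps)
    also have "\<dots> \<le> 2 / (1 - cmod w)"
      using w by (intro divide_right_mono) auto
    finally have "P \<theta> \<le> 2 / (1 - cmod w) / (2*pi)"
      unfolding P_def by (rule divide_right_mono) simp
    then have "P \<theta> * cmod (F (cis \<theta>)) powr p \<le> 2 / (1 - cmod w) / (2*pi) * cmod (F (cis \<theta>)) powr p"
      by (rule mult_right_mono) simp
    then show "P \<theta> * cmod (F (cis \<theta>)) powr p \<le> 2 / (1 - cmod w) * (cmod (F (cis \<theta>)) powr p / (2*pi))"
      by simp
    show "(\<lambda>\<theta>. P \<theta> * cmod (F (cis \<theta>)) powr p) integrable_on {0..2*pi}"
      using IFp by blast
    show "(\<lambda>\<theta>. 2 / (1 - cmod w) * (cmod (F (cis \<theta>)) powr p / (2*pi))) integrable_on {0..2*pi}"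
      by (intro integrable_on_mult_right integrable_on_divide integrable_continuous_real contFp)
  qed
  also have "\<dots> = 2 / (1 - cmod w) * hardy_mean p F 1"
    by (simp add: hardy_mean_def)
  finally show ?thesis by (simp add: a_def)
qed

lemma hardy_mean_le_norm_powr:
  assumes "f \<in> hardy_space p" "1 \<le> p" "0 \<le> r" "r < 1"
  shows "hardy_mean p f r \<le> hardy_norm p f powr p"
proof -
  have bdd: "bdd_above (hardy_mean p f ` {0..<1})"
    using assms by (simp add: hardy_space_def)
  then have le: "hardy_mean p f r \<le> (SUP r\<in>{0..<1}. hardy_mean p f r)"
    using assms by (intro cSUP_upper) auto
  with hardy_mean_nonneg[of p f r] assms show ?thesis
    by (simp add: hardy_norm_def powr_powr)
qed

text \<open>A Hardy function need not extend continuously to the circle, but its dilation z -> f (r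
  * z) with r < 1 does. The bound for such functions is applied to the dilation at w / r; its mean
  over the unit circle is the mean of f at radius r.\<close>

lemma hardy_point_evaluation:
  assumes f: "f \<in> hardy_space p" and p: "1 \<le> p" and w: "cmod w < 1"
  shows "cmod (f w) powr p \<le> 4 / (1 - cmod w) * hardy_norm p f powr p"
proof -
  \<comment> \<open>The midpoint between |w| and 1 makes 1 - |w| / r at least (1 - |w|) / 2, so the
    constant 2 only grows to 4.\<close>
  define r where "r = (1 + cmod w) / 2"
  have r: "0 < r" "r < 1" "cmod w < r"
    using w by (auto simp: r_def add_pos_nonneg)
  define F where "F z = f (of_real r * z)" for z
  have hol: "f holomorphic_on ball 0 1"
    using f by (simp add: hardy_space_def)
  have *: "(\<lambda>z::complex. of_real r * z) ` cball 0 1 \<subseteq> ball 0 1"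
  proof (rule image_subsetI)
    fix z :: complex assume "z \<in> cball 0 1"
    then have "cmod z \<le> 1" by simp
    then have "r * cmod z \<le> r * 1" using r(1) by (intro mult_left_mono) auto
    then have "r * cmod z < 1" using r(2) by linarith
    then show "of_real r * z \<in> ball 0 1" using r(1) by (simp add: norm_mult)
  qed
  have "F holomorphic_on cball 0 1"
    unfolding F_def
    by (rule holomorphic_on_compose_gen[OF _ hol *, unfolded o_def]) (intro holomorphic_intros)
  then have F: "continuous_on (cball 0 1) F" "F holomorphic_on ball 0 1"
    by (auto intro: holomorphic_on_imp_continuous_on holomorphic_on_subset)
  have norm: "cmod (w / of_real r) = cmod w / r"
    using r(1) by (simp add: norm_divide)
  have "cmod (F (w / of_real r)) powr p \<le> 2 / (1 - cmod (w / of_real r)) * hardy_mean p F 1"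
    using r(3) divide_less_eq_1_pos[OF r(1)] by (intro norm_powr_le_hardy_mean_1 F p) (simp add: norm)
  moreover have "F (w / of_real r) = f w"
    using r(1) by (simp add: F_def)
  moreover have "hardy_mean p F 1 = hardy_mean p f r"
    by (simp add: hardy_mean_def F_def)
  ultimately have "cmod (f w) powr p \<le> 2 / (1 - cmod w / r) * hardy_mean p f r"
    by (simp add: norm)
  also have "\<dots> \<le> 4 / (1 - cmod w) * hardy_norm p f powr p"
  proof (rule mult_mono)
    have "(1 - cmod w) * r / 2 \<le> (1 - cmod w) * 1 / 2"
      using r w by (intro divide_right_mono mult_left_mono) auto
    then have "(1 - cmod w) / 2 * r \<le> r - cmod w"
      by (simp add: r_def)
    then have "(1 - cmod w) / 2 \<le> 1 - cmod w / r"
      using r(1) by (simp add: field_simps)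
    moreover have "0 < 1 - cmod w / r"
      using r(3) divide_less_eq_1_pos[OF r(1)] by simp
    ultimately have "2 / (1 - cmod w / r) \<le> 2 / ((1 - cmod w) / 2)"
      using w by (intro divide_left_mono mult_pos_pos) auto
    then show "2 / (1 - cmod w / r) \<le> 4 / (1 - cmod w)" by simp
    show "hardy_mean p f r \<le> hardy_norm p f powr p"
      using hardy_mean_le_norm_powr[OF f p] r by simp
  qed (use w in \<open>auto simp: hardy_mean_nonneg\<close>)
  finally show ?thesis .
qed

section \<open>Test functions in the unit ball\<close>

text \<open>For |a| < 1 and |z| < 1 the base 1 - cnj a * z has positive real part, so the principal
  branch of its power is holomorphic in z.\<close>

definition test_fun :: "real \<Rightarrow> complex \<Rightarrow> complex \<Rightarrow> complex" where
  "test_fun p a z = of_real ((1 - (cmod a)\<^sup>2) powr (1/p)) / (1 - cnj a * z) powr of_real (2/p)"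

text \<open>The exponent 2/p is real, so the modulus does not depend on the branch. This holds for
  every z: where 1 - cnj a * z vanishes, both sides are 0 because division by 0 gives 0.\<close>

lemma norm_test_fun_powr:
  assumes "1 \<le> p" "cmod a < 1"
  shows "cmod (test_fun p a z) powr p = poisson_kernel a z"
proof -
  have w2: "1 - (cmod a)\<^sup>2 > 0"
    using assms by (simp add: power_less_one_iff)
  have "cmod (1 - cnj a * z) powr 2 = (cmod (1 - cnj a * z))\<^sup>2"
    by simp
  then show ?thesis
    using assms w2
    by (simp add: test_fun_def poisson_kernel_def norm_divide norm_powr_real_powr' powr_divide powr_powr)
qed

lemma holomorphic_test_fun:
  assumes "cmod a < 1"
  shows "test_fun p a holomorphic_on ball 0 1"
proof -
  have "1 - cnj a * z \<notin> \<real>\<^sub>\<le>\<^sub>0" if "cmod z < 1" for z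
  proof -
    have "Re (cnj a * z) \<le> cmod a * cmod z"
      using complex_Re_le_cmod[of "cnj a * z"] by (simp add: norm_mult)
    also have "\<dots> < 1 * 1"
      using assms that by (intro mult_strict_mono') auto
    finally show ?thesis by (auto simp: complex_nonpos_Reals_iff)
  qed
  then have "(\<lambda>z. of_real ((1 - (cmod a)\<^sup>2) powr (1/p)) / (1 - cnj a * z) powr of_real (2/p)) holomorphic_on ball 0 1"
    by (intro holomorphic_intros) (use one_minus_cnj_mult_nonzero[OF assms] in auto)
  then show ?thesis by (simp add: test_fun_def[abs_def])
qed

text \<open>
  On the circle of radius \<open>r\<close> the Poisson kernel of \<open>a\<close> is a multiple of the one of \<open>r * a\<close>, and
  the latter has mean 1.
\<close>

lemma hardy_mean_test_fun_le_1:
  assumes p: "1 \<le> p" and a: "cmod a < 1" and r: "0 \<le> r" "r < 1"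
  shows "hardy_mean p (test_fun p a) r \<le> 1"
proof -
  define b where "b = of_real r * a"
  have ba: "cmod b \<le> cmod a"
    using r by (simp add: b_def norm_mult mult_left_le_one_le)
  then have b: "cmod b < 1" using a by simp
  have sq: "(cmod b)\<^sup>2 \<le> (cmod a)\<^sup>2" "(cmod a)\<^sup>2 < 1" "(cmod b)\<^sup>2 < 1"
    using ba a b by (auto intro: power_mono simp: power_less_one_iff)
  \<comment> \<open>Since cnj a * (r * cis \<theta>) = cnj b * cis \<theta>, the kernels of a and b
    have equal denominators here, and q is the ratio of their numerators.\<close>
  define q where "q = (1 - (cmod a)\<^sup>2) / (1 - (cmod b)\<^sup>2)"
  have q: "q \<le> 1" using sq by (simp add: q_def)
  have "((\<lambda>\<theta>. of_real (poisson_kernel b (cis \<theta>) / (2*pi)) :: complex) has_integral 1) {0..2*pi}"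
    using poisson_formula[of "\<lambda>_. 1" b] b by simp
  from has_integral_linear[OF this bounded_linear_Re]
  have "((\<lambda>\<theta>. poisson_kernel b (cis \<theta>) / (2*pi)) has_integral 1) {0..2*pi}"
    by (simp only: o_def Re_complex_of_real one_complex.sel)
  from has_integral_mult_right[OF this, of q]
  have "((\<lambda>\<theta>. q * (poisson_kernel b (cis \<theta>) / (2*pi))) has_integral q) {0..2*pi}"
    by simp
  moreover have "q * (poisson_kernel b (cis \<theta>) / (2*pi)) =
      cmod (test_fun p a (of_real r * cis \<theta>)) powr p / (2*pi)" for \<theta>
    unfolding norm_test_fun_powr[OF p a] using sq
    by (simp add: poisson_kernel_def q_def b_def mult_ac)
  ultimately have "hardy_mean p (test_fun p a) r = q"
    unfolding hardy_mean_def by (simp only: integral_unique)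
  with q show ?thesis by simp
qed

lemma test_fun_in_hardy_space:
  assumes "1 \<le> p" "cmod a < 1"
  shows "test_fun p a \<in> hardy_space p"
  unfolding hardy_space_def
  using holomorphic_test_fun[OF assms(2)] hardy_mean_test_fun_le_1[OF assms]
  by (auto intro!: bdd_aboveI[of _ 1])

lemma hardy_norm_test_fun_le_1:
  assumes "1 \<le> p" "cmod a < 1"
  shows "hardy_norm p (test_fun p a) \<le> 1"
proof -
  let ?s = "SUP r\<in>{0..<1}. hardy_mean p (test_fun p a) r"
  have "?s \<le> 1"
    using hardy_mean_test_fun_le_1[OF assms] by (intro cSUP_least) auto
  moreover have "0 \<le> ?s"
    using hardy_mean_test_fun_le_1[OF assms]
    by (intro cSUP_upper2[of _ _ 0] bdd_aboveI[of _ 1]) (auto simp: hardy_mean_nonneg)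
  ultimately show ?thesis
    unfolding hardy_norm_def using assms powr_mono2[of "1/p" ?s 1] by simp
qed

section \<open>Differences of Hardy functions\<close>

text \<open>Allows point evaluation of T f - g in the compact case. Only finiteness of the means
  matters, so the crude estimate |x - y| <= 2 * max |x| |y| replaces Minkowski's inequality.\<close>

lemma hardy_space_diff:
  assumes f: "f \<in> hardy_space p" and g: "g \<in> hardy_space p" and p: "1 \<le> p"
  shows "(\<lambda>z. f z - g z) \<in> hardy_space p"
proof -
  obtain A where A: "\<And>r. r \<in> {0..<1} \<Longrightarrow> hardy_mean p f r \<le> A"
    using f unfolding hardy_space_def bdd_above_def by blast
  obtain B where B: "\<And>r. r \<in> {0..<1} \<Longrightarrow> hardy_mean p g r \<le> B"
    using g unfolding hardy_space_def bdd_above_def by blast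
  have hol: "f holomorphic_on ball 0 1" "g holomorphic_on ball 0 1"
    using f g by (auto simp: hardy_space_def)
  have int: "(\<lambda>\<theta>. cmod (k (of_real r * cis \<theta>)) powr p / (2*pi)) integrable_on {0..2*pi}"
    if "k holomorphic_on ball 0 1" "r \<in> {0..<1}" for k :: "complex \<Rightarrow> complex" and r
  proof -
    have "continuous_on {0..2*pi} (\<lambda>\<theta>. k (of_real r * cis \<theta>))"
      by (rule continuous_on_compose2[OF holomorphic_on_imp_continuous_on[OF that(1)]])
        (use that(2) in \<open>auto intro!: continuous_intros simp: norm_mult\<close>)
    then have "continuous_on {0..2*pi} (\<lambda>\<theta>. cmod (k (of_real r * cis \<theta>)) powr p)"
      by (intro continuous_on_powr' continuous_intros) (use p in auto)
    then show ?thesis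
      by (intro integrable_on_divide integrable_continuous_real)
  qed
  have pw: "cmod (x - y) powr p \<le> 2 powr p * (cmod x powr p + cmod y powr p)" for x y
  proof -
    have "cmod (x - y) \<le> 2 * max (cmod x) (cmod y)"
      using norm_triangle_ineq4[of x y] by linarith
    then have "cmod (x - y) powr p \<le> (2 * max (cmod x) (cmod y)) powr p"
      using p by (intro powr_mono2) auto
    also have "\<dots> = 2 powr p * max (cmod x) (cmod y) powr p"
      by (intro powr_mult)
    also have "\<dots> \<le> 2 powr p * (cmod x powr p + cmod y powr p)"
      by (intro mult_left_mono) (auto simp: max_def)
    finally show ?thesis .
  qed
  have "hardy_mean p (\<lambda>z. f z - g z) r \<le> 2 powr p * (A + B)" if r: "r \<in> {0..<1}" for r
  proof -
    let ?z = "\<lambda>\<theta>. of_real r * cis \<theta>"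
    have "hardy_mean p (\<lambda>z. f z - g z) r \<le>
        integral {0..2*pi} (\<lambda>\<theta>. 2 powr p * (cmod (f (?z \<theta>)) powr p / (2*pi) + cmod (g (?z \<theta>)) powr p / (2*pi)))"
      unfolding hardy_mean_def
    proof (rule integral_le)
      show "(\<lambda>\<theta>. 2 powr p * (cmod (f (?z \<theta>)) powr p / (2*pi) + cmod (g (?z \<theta>)) powr p / (2*pi))) integrable_on {0..2*pi}"
        by (intro integrable_on_mult_right integrable_add int hol r)
      show "(\<lambda>\<theta>. cmod (f (?z \<theta>) - g (?z \<theta>)) powr p / (2*pi)) integrable_on {0..2*pi}"
        by (rule int[of "\<lambda>z. f z - g z"]) (intro holomorphic_intros hol r)+
      show "cmod (f (?z \<theta>) - g (?z \<theta>)) powr p / (2*pi) \<le>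
          2 powr p * (cmod (f (?z \<theta>)) powr p / (2*pi) + cmod (g (?z \<theta>)) powr p / (2*pi))" for \<theta>
        using divide_right_mono[OF pw[of "f (?z \<theta>)" "g (?z \<theta>)"], of "2*pi"]
        by (simp only: add_divide_distrib[symmetric] times_divide_eq_right) simp
    qed
    also have "\<dots> = 2 powr p * (hardy_mean p f r + hardy_mean p g r)"
      unfolding hardy_mean_def by (simp only: integral_mult_right integral_add[OF int[OF hol(1) r] int[OF hol(2) r]])
    also have "\<dots> \<le> 2 powr p * (A + B)"
      using A[OF r] B[OF r] by (intro mult_left_mono) auto
    finally show ?thesis .
  qed
  then have "bdd_above (hardy_mean p (\<lambda>z. f z - g z) ` {0..<1})"
    by (intro bdd_aboveI2)
  then show ?thesis
    using hol by (auto simp: hardy_space_def intro!: holomorphic_intros)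
qed

section \<open>The symbol near points with finite angular derivative\<close>

text \<open>Near \<zeta> the difference quotient is bounded by |L| + 1, so 1 - |\<phi> z| <= |\<phi>
  z - \<eta>| <= (|L| + 1) * |z - \<zeta>|, and the Stolz condition bounds |z - \<zeta>| by M * (1 -
  |z|). Away from \<zeta> the same condition keeps 1 - |z| bounded below.\<close>

lemma angular_derivative_stolz_bound:
  assumes \<zeta>: "\<zeta> \<in> angular_derivative_set \<phi>" and M: "M > 1"
  obtains K where "K > 0" "\<And>z. z \<in> stolz_domain \<zeta> M \<Longrightarrow> 1 - cmod (\<phi> z) \<le> K * (1 - cmod z)"
proof -
  obtain \<eta> L where \<eta>: "cmod \<eta> = 1"
    and lim: "((\<lambda>z. (\<phi> z - \<eta>) / (z - \<zeta>)) \<longlongrightarrow> L) (at \<zeta> within stolz_domain \<zeta> M)"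
    using \<zeta> M by (auto simp: angular_derivative_set_def has_finite_angular_derivative_def
        has_nontangential_limit_def)
  from \<zeta> have norm\<zeta>: "cmod \<zeta> = 1"
    by (simp add: angular_derivative_set_def)
  from tendstoD[OF lim zero_less_one] obtain d where d: "d > 0"
    and near: "\<And>z. z \<in> stolz_domain \<zeta> M \<Longrightarrow> z \<noteq> \<zeta> \<Longrightarrow> dist z \<zeta> < d \<Longrightarrow>
      dist ((\<phi> z - \<eta>) / (z - \<zeta>)) L < 1"
    unfolding eventually_at by blast
  \<comment> \<open>The first entry serves |z - \<zeta>| < d; the second serves the rest, where 1 -
    |z| > d / M.\<close>
  define K where "K = max ((cmod L + 1) * M) (M / d)"
  show thesis
  proof
    have "M / d > 0" using M d by simp
    then show "K > 0" unfolding K_def by simp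
    fix z assume z: "z \<in> stolz_domain \<zeta> M"
    then have z1: "cmod z < 1" and zM: "cmod (z - \<zeta>) < M * (1 - cmod z)"
      by (auto simp: stolz_domain_def)
    show "1 - cmod (\<phi> z) \<le> K * (1 - cmod z)"
    proof (cases "dist z \<zeta> < d")
      case True
      have ne: "z \<noteq> \<zeta>" using z1 norm\<zeta> by auto
      have "cmod ((\<phi> z - \<eta>) / (z - \<zeta>)) \<le> cmod L + 1"
        using near[OF z ne True] norm_triangle_ineq2[of "(\<phi> z - \<eta>) / (z - \<zeta>)" L]
        by (simp add: dist_norm)
      then have "cmod (\<phi> z - \<eta>) \<le> (cmod L + 1) * cmod (z - \<zeta>)"
        using ne by (simp add: norm_divide field_simps)
      also have "\<dots> \<le> (cmod L + 1) * (M * (1 - cmod z))"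
        using zM by (intro mult_left_mono) auto
      also have "\<dots> = (cmod L + 1) * M * (1 - cmod z)"
        by simp
      also have "\<dots> \<le> K * (1 - cmod z)"
        using z1 by (intro mult_right_mono) (auto simp: K_def)
      finally show ?thesis
        using norm_triangle_ineq2[of \<eta> "\<phi> z"] \<eta> by (simp add: norm_minus_commute)
    next
      case False
      then have "d \<le> M * (1 - cmod z)"
        using zM by (simp add: dist_norm)
      then have "1 \<le> M / d * (1 - cmod z)"
        using d by (simp add: field_simps)
      also have "\<dots> \<le> K * (1 - cmod z)"
        using z1 by (intro mult_right_mono) (auto simp: K_def)
      finally show ?thesis
        using norm_ge_zero[of "\<phi> z"] by linarith
    qed
  qed
qed

section \<open>Estimating the weight through test functions\<close>

text \<open>\<open>G\<close> has to agree with the image of the test function only at w. The bounded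
  case takes the image itself; the compact case takes its difference from a limit that vanishes on
  the disc.\<close>

lemma norm_le_weighted_comp_test_fun:
  assumes p: "1 \<le> p" and w: "cmod w < 1" and a: "cmod (\<phi> w) < 1"
    and K: "1 - cmod (\<phi> w) \<le> K * (1 - cmod w)"
    and G: "G \<in> hardy_space p" "G w = weighted_comp h \<phi> (test_fun p (\<phi> w)) w"
  shows "cmod (h w) powr p \<le> 8 * K * hardy_norm p G powr p"
proof -
  let ?a = "\<phi> w"
  have w2: "1 - (cmod ?a)\<^sup>2 > 0"
    using a by (simp add: power_less_one_iff)
  have "1 - cnj ?a * ?a = of_real (1 - (cmod ?a)\<^sup>2)"
    using complex_norm_square[of ?a] by (simp add: mult.commute)
  then have "cmod (1 - cnj ?a * ?a) = 1 - (cmod ?a)\<^sup>2"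
    using w2 by (simp only: norm_of_real)
  \<comment> \<open>At its own centre a the test function is large: |k a|^p = 1 / (1 - |a|^2). This
    gain offsets the loss 1 / (1 - |w|) of point evaluation.\<close>
  then have k: "poisson_kernel ?a ?a = 1 / (1 - (cmod ?a)\<^sup>2)"
    using w2 by (simp add: poisson_kernel_def power2_eq_square)
  have "cmod (h w) powr p / (1 - (cmod ?a)\<^sup>2) = cmod (G w) powr p"
    unfolding G(2) weighted_comp_def norm_mult powr_mult norm_test_fun_powr[OF p a] k by simp
  also have "\<dots> \<le> 4 / (1 - cmod w) * hardy_norm p G powr p"
    by (rule hardy_point_evaluation[OF G(1) p w])
  finally have "cmod (h w) powr p \<le> (1 - (cmod ?a)\<^sup>2) * (4 / (1 - cmod w) * hardy_norm p G powr p)"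
    using w2 by (simp add: pos_divide_le_eq mult.commute)
  also have "1 - (cmod ?a)\<^sup>2 = (1 + cmod ?a) * (1 - cmod ?a)"
    by (simp add: power2_eq_square algebra_simps)
  \<comment> \<open>The constant 8 is 2 * 4, with 2 from 1 + |a| <= 2 and 4 from point
    evaluation.\<close>
  also have "(1 + cmod ?a) * (1 - cmod ?a) * (4 / (1 - cmod w) * hardy_norm p G powr p) \<le>
      2 * (K * (1 - cmod w)) * (4 / (1 - cmod w) * hardy_norm p G powr p)"
    using K a w by (intro mult_right_mono mult_mono) auto
  also have "\<dots> = 8 * K * hardy_norm p G powr p"
    using w by simp
  finally show ?thesis .
qed

section \<open>Consequences of compactness\<close>

text \<open>For fixed z the denominator of |k|^p stays above (1 - |z|)^2, while the numerator 1 -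
  |a|^2 tends to 0.\<close>

lemma test_fun_tendsto_0:
  assumes p: "1 \<le> p" and a: "\<And>n. cmod (a n) < 1" and lim: "(\<lambda>n. cmod (a n)) \<longlonglongrightarrow> 1"
    and z: "cmod z < 1"
  shows "(\<lambda>n. test_fun p (a n) z) \<longlonglongrightarrow> 0"
proof -
  have "(\<lambda>n. poisson_kernel (a n) z) \<longlonglongrightarrow> 0"
  proof (rule tendsto_sandwich[OF always_eventually always_eventually tendsto_const])
    show "\<forall>n. 0 \<le> poisson_kernel (a n) z"
      using a by (auto simp: poisson_kernel_def power_le_one_iff less_imp_le)
    show "\<forall>n. poisson_kernel (a n) z \<le> (1 - (cmod (a n))\<^sup>2) / (1 - cmod z)\<^sup>2"
    proof
      fix n
      have "cmod (a n) * cmod z \<le> 1 * cmod z"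
        using a[of n] by (intro mult_right_mono) auto
      then have "1 - cmod z \<le> cmod (1 - cnj (a n) * z)"
        using norm_triangle_ineq2[of 1 "cnj (a n) * z"] by (simp add: norm_mult)
      then have "(1 - cmod z)\<^sup>2 \<le> (cmod (1 - cnj (a n) * z))\<^sup>2"
        using z by (intro power_mono) auto
      moreover have "1 - cnj (a n) * z \<noteq> 0"
        using one_minus_cnj_mult_nonzero[OF a] z by simp
      ultimately show "poisson_kernel (a n) z \<le> (1 - (cmod (a n))\<^sup>2) / (1 - cmod z)\<^sup>2"
        unfolding poisson_kernel_def using z a[of n]
        by (intro divide_left_mono mult_pos_pos) (auto simp: power_le_one_iff)
    qed
    have "(\<lambda>n. (1 - (cmod (a n))\<^sup>2) / (1 - cmod z)\<^sup>2) \<longlonglongrightarrow> (1 - 1\<^sup>2) / (1 - cmod z)\<^sup>2"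
      using z by (intro tendsto_intros lim) auto
    then show "(\<lambda>n. (1 - (cmod (a n))\<^sup>2) / (1 - cmod z)\<^sup>2) \<longlonglongrightarrow> 0" by simp
  qed
  then have "(\<lambda>n. poisson_kernel (a n) z powr (1/p)) \<longlonglongrightarrow> 0 powr (1/p)"
    using p a by (intro tendsto_powr') (auto simp: poisson_kernel_def power_le_one_iff less_imp_le)
  moreover have "poisson_kernel (a n) z powr (1/p) = cmod (test_fun p (a n) z)" for n
    unfolding norm_test_fun_powr[OF p a, symmetric] using p by (simp add: powr_powr)
  ultimately show ?thesis
    using p by (simp add: tendsto_norm_zero_iff)
qed

text \<open>A lower bound e valid for all n survives the passage to the subsequence supplied by
  compactness. Along it the images of the test functions tend to 0 in norm, which the estimate of
  the weight forbids.\<close>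

lemma weighted_comp_compact_no_lower_bound:
  assumes \<phi>: "\<phi> ` ball 0 1 \<subseteq> ball 0 1" and p: "1 \<le> p"
    and comp: "compact_on_hardy p (weighted_comp h \<phi>)"
    and z: "\<And>n. cmod (z n) < 1" and lim: "(\<lambda>n. cmod (z n)) \<longlonglongrightarrow> 1"
    and K: "K > 0" "\<And>n. 1 - cmod (\<phi> (z n)) \<le> K * (1 - cmod (z n))"
    and e: "e > 0"
  shows "\<exists>n. cmod (h (z n)) < e"
proof (rule ccontr)
  assume "\<not> ?thesis"
  then have ge: "e \<le> cmod (h (z n))" for n by (simp add: not_less)
  let ?T = "weighted_comp h \<phi>"
  have \<phi>1: "cmod (\<phi> u) < 1" if "cmod u < 1" for u
    using \<phi> that by force
  \<comment> \<open>The bound with \<open>K\<close> forces the centres \<phi> (z n) to the circle,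
    so the test functions tend to 0 pointwise.\<close>
  have lim\<phi>: "(\<lambda>n. cmod (\<phi> (z n))) \<longlonglongrightarrow> 1"
  proof (rule tendsto_sandwich[OF always_eventually always_eventually _ tendsto_const])
    show "\<forall>n. 1 - K * (1 - cmod (z n)) \<le> cmod (\<phi> (z n))"
      using K(2) by (auto simp: algebra_simps)
    show "\<forall>n. cmod (\<phi> (z n)) \<le> 1"
      using \<phi>1[OF z] by (auto intro: less_imp_le)
    have "(\<lambda>n. 1 - K * (1 - cmod (z n))) \<longlonglongrightarrow> 1 - K * (1 - 1)"
      by (intro tendsto_intros lim)
    then show "(\<lambda>n. 1 - K * (1 - cmod (z n))) \<longlonglongrightarrow> 1" by simp
  qed
  define f where "f n = test_fun p (\<phi> (z n))" for n
  have f: "f n \<in> hardy_space p" "hardy_norm p (f n) \<le> 1" for n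
    using test_fun_in_hardy_space[OF p] hardy_norm_test_fun_le_1[OF p] \<phi>1[OF z] by (auto simp: f_def)
  then have "bdd_above (range (\<lambda>n. hardy_norm p (f n)))"
    by (auto intro!: bdd_aboveI[of _ 1])
  with f comp obtain s g where s: "strict_mono (s :: nat \<Rightarrow> nat)" and g: "g \<in> hardy_space p"
    and conv: "(\<lambda>n. hardy_norm p (\<lambda>u. ?T (f (s n)) u - g u)) \<longlonglongrightarrow> 0"
    unfolding compact_on_hardy_def by blast
  define D where "D n = (\<lambda>u. ?T (f (s n)) u - g u)" for n
  have D: "D n \<in> hardy_space p" for n
    unfolding D_def using f comp g p by (intro hardy_space_diff) (auto simp: compact_on_hardy_def)
  have Dp: "(\<lambda>n. hardy_norm p (D n) powr p) \<longlonglongrightarrow> 0"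
    using tendsto_powr'[OF conv[folded D_def] tendsto_const[of p]] p by (simp add: hardy_norm_def)
  \<comment> \<open>Norm convergence implies pointwise convergence by point evaluation, so
    \<open>D n u\<close> tends to 0; pointwise decay of the test functions makes it tend to - g u as
    well.\<close>
  have g0: "g u = 0" if u: "cmod u < 1" for u
  proof -
    have "(\<lambda>n. 4 / (1 - cmod u) * hardy_norm p (D n) powr p) \<longlonglongrightarrow> 4 / (1 - cmod u) * 0"
      by (intro tendsto_mult Dp tendsto_const)
    then have "(\<lambda>n. 4 / (1 - cmod u) * hardy_norm p (D n) powr p) \<longlonglongrightarrow> 0"
      by simp
    then have lim0: "(\<lambda>n. cmod (D n u) powr p) \<longlonglongrightarrow> 0"
      by (rule tendsto_sandwich[OF always_eventually always_eventually tendsto_const, rotated 2])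
        (intro allI hardy_point_evaluation[OF D p u] powr_ge_zero)+
    have "(\<lambda>n. D n u) \<longlonglongrightarrow> h u * 0 - g u"
    proof -
      have "(\<lambda>n. f n (\<phi> u)) \<longlonglongrightarrow> 0"
        unfolding f_def using \<phi>1 z u by (intro test_fun_tendsto_0[OF p] lim\<phi>) auto
      then have "(\<lambda>n. f (s n) (\<phi> u)) \<longlonglongrightarrow> 0"
        using LIMSEQ_subseq_LIMSEQ[OF _ s] by (force simp: o_def)
      then show ?thesis
        unfolding D_def weighted_comp_def by (intro tendsto_diff tendsto_mult tendsto_const)
    qed
    then have "(\<lambda>n. cmod (D n u) powr p) \<longlonglongrightarrow> cmod (h u * 0 - g u) powr p"
      using p by (intro tendsto_powr' tendsto_norm tendsto_const) auto
    from LIMSEQ_unique[OF this lim0] have "cmod (g u) powr p = 0"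
      by simp
    then show ?thesis by simp
  qed
  have "e powr p \<le> 8 * K * hardy_norm p (D n) powr p" for n
  proof -
    have "e powr p \<le> cmod (h (z (s n))) powr p"
      using ge e p by (intro powr_mono2) auto
    \<comment> \<open>Since g vanishes at z (s n), \<open>D n\<close> agrees there with the image of
      the test function.\<close>
    also have "\<dots> \<le> 8 * K * hardy_norm p (D n) powr p"
      using z \<phi>1[OF z] K(2) D by (intro norm_le_weighted_comp_test_fun[OF p, where \<phi> = \<phi>]) (auto simp: D_def f_def g0)
    finally show ?thesis .
  qed
  moreover have "(\<lambda>n. 8 * K * hardy_norm p (D n) powr p) \<longlonglongrightarrow> 8 * K * 0"
    by (intro tendsto_intros Dp)
  ultimately have "e powr p \<le> 8 * K * 0"
    by (intro LIMSEQ_le_const) auto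
  with e show False by simp
qed

section \<open>Boundedness and decay of the weight on Stolz domains\<close>

theorem proposition2p3:
  fixes \<phi> h :: "complex \<Rightarrow> complex" and p :: real
  assumes "\<phi> holomorphic_on ball 0 1"
    and "\<phi> ` ball 0 1 \<subseteq> ball 0 1"
    and "1 \<le> p"
    and "h \<in> hardy_space p"
  shows "(bounded_on_hardy p (weighted_comp h \<phi>) \<longrightarrow>
            (\<forall>\<zeta>\<in>angular_derivative_set \<phi>. \<forall>M>1. bounded (h ` stolz_domain \<zeta> M))) \<and>
         (compact_on_hardy p (weighted_comp h \<phi>) \<longrightarrow>
            (\<forall>\<zeta>\<in>angular_derivative_set \<phi>. \<forall>M>1.
               (h \<longlongrightarrow> 0) (inf (filtercomap cmod (at_left 1)) (principal (stolz_domain \<zeta> M)))))"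
proof (intro conjI impI ballI allI)
  fix \<zeta> M
  assume bdd: "bounded_on_hardy p (weighted_comp h \<phi>)"
    and \<zeta>: "\<zeta> \<in> angular_derivative_set \<phi>" and M: "(1::real) < M"
  let ?T = "weighted_comp h \<phi>"
  from \<zeta> M obtain K where K: "K > 0" "\<And>z. z \<in> stolz_domain \<zeta> M \<Longrightarrow> 1 - cmod (\<phi> z) \<le> K * (1 - cmod z)"
    by (rule angular_derivative_stolz_bound) blast
  from bdd obtain C where T: "\<And>f. f \<in> hardy_space p \<Longrightarrow> ?T f \<in> hardy_space p"
    and C: "\<And>f. f \<in> hardy_space p \<Longrightarrow> hardy_norm p (?T f) \<le> C * hardy_norm p f"
    unfolding bounded_on_hardy_def by blast
  have "cmod (h z) \<le> (8 * K * \<bar>C\<bar> powr p) powr (1/p)" if z: "z \<in> stolz_domain \<zeta> M" for z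
  proof -
    have z1: "cmod z < 1" using z by (simp add: stolz_domain_def)
    then have a: "cmod (\<phi> z) < 1" using assms(2) by force
    let ?k = "test_fun p (\<phi> z)"
    have k: "?k \<in> hardy_space p" by (rule test_fun_in_hardy_space[OF assms(3) a])
    \<comment> \<open>The sign of \<open>C\<close> is not prescribed; |C| is nonnegative and can be
      combined with the norm bound 1 for \<open>?k\<close>.\<close>
    have "hardy_norm p (?T ?k) \<le> \<bar>C\<bar> * hardy_norm p ?k"
      using C[OF k] mult_right_mono[OF abs_ge_self[of C], of "hardy_norm p ?k"] by (simp add: hardy_norm_def)
    also have "\<dots> \<le> \<bar>C\<bar>"
      using hardy_norm_test_fun_le_1[OF assms(3) a] by (simp add: mult_left_le)
    finally have le: "hardy_norm p (?T ?k) powr p \<le> \<bar>C\<bar> powr p"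
      using assms(3) by (intro powr_mono2) (auto simp: hardy_norm_def)
    have "cmod (h z) powr p \<le> 8 * K * hardy_norm p (?T ?k) powr p"
      using norm_le_weighted_comp_test_fun[where \<phi> = \<phi>, OF assms(3) z1 a K(2)[OF z] T[OF k] refl] .
    also have "\<dots> \<le> 8 * K * \<bar>C\<bar> powr p"
      using le K(1) by (intro mult_left_mono) auto
    finally have "(cmod (h z) powr p) powr (1/p) \<le> (8 * K * \<bar>C\<bar> powr p) powr (1/p)"
      using assms(3) by (intro powr_mono2) auto
    then show ?thesis using assms(3) by (simp add: powr_powr)
  qed
  then show "bounded (h ` stolz_domain \<zeta> M)"
    by (auto simp: bounded_iff)
next
  fix \<zeta> M
  assume comp: "compact_on_hardy p (weighted_comp h \<phi>)"
    and \<zeta>: "\<zeta> \<in> angular_derivative_set \<phi>" and M: "(1::real) < M"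
  from \<zeta> M obtain K where K: "K > 0" "\<And>z. z \<in> stolz_domain \<zeta> M \<Longrightarrow> 1 - cmod (\<phi> z) \<le> K * (1 - cmod z)"
    by (rule angular_derivative_stolz_bound) blast
  let ?F = "inf (filtercomap cmod (at_left 1)) (principal (stolz_domain \<zeta> M))"
  show "(h \<longlongrightarrow> 0) ?F"
  proof (rule tendstoI, rule ccontr)
    fix e :: real assume e: "e > 0"
    assume not_ev: "\<not> eventually (\<lambda>z. dist (h z) 0 < e) ?F"
    \<comment> \<open>If some n had no such z, the annulus 1 - 1 / (n + 1) < |z| < 1 would witness
      that |h| < e holds eventually along the filter. The chosen points form a sequence tending to
      the circle with |h| >= e.\<close>
    have "\<exists>z \<in> stolz_domain \<zeta> M. cmod z > 1 - 1 / real (Suc n) \<and> e \<le> cmod (h z)" for n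
    proof (rule ccontr)
      assume "\<not> ?thesis"
      then have *: "\<And>z. z \<in> stolz_domain \<zeta> M \<Longrightarrow> cmod z > 1 - 1 / real (Suc n) \<Longrightarrow> cmod (h z) < e"
        by force
      have "eventually (\<lambda>x. x \<in> {1 - 1 / real (Suc n)<..<1}) (at_left (1::real))"
        by (rule eventually_at_left_real) simp
      then have "eventually (\<lambda>z. cmod z \<in> {1 - 1 / real (Suc n)<..<1}) (filtercomap cmod (at_left 1))"
        by (rule eventually_filtercomapI)
      then have "eventually (\<lambda>z. dist (h z) 0 < e) ?F"
        unfolding eventually_inf_principal by (rule eventually_mono) (use * in auto)
      with not_ev show False by simp
    qed
    then obtain z where z: "\<And>n. z n \<in> stolz_domain \<zeta> M" "\<And>n. cmod (z n) > 1 - 1 / real (Suc n)"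
      "\<And>n. e \<le> cmod (h (z n))"
      by metis
    have z1: "cmod (z n) < 1" for n using z(1)[of n] by (simp add: stolz_domain_def)
    have "(\<lambda>n. 1 - 1 / real (Suc n)) \<longlonglongrightarrow> 1 - 0"
      using LIMSEQ_inverse_real_of_nat by (intro tendsto_intros) (simp add: inverse_eq_divide)
    then have "(\<lambda>n. 1 - 1 / real (Suc n)) \<longlonglongrightarrow> 1" by simp
    then have "(\<lambda>n. cmod (z n)) \<longlonglongrightarrow> 1"
      by (rule tendsto_sandwich[OF always_eventually always_eventually _ tendsto_const, rotated 2])
        (intro allI less_imp_le z(2) z1)+
    from weighted_comp_compact_no_lower_bound[OF assms(2,3) comp z1 this K(1) K(2)[OF z(1)] e]
    show False using z(3) by (meson not_less)
  qed
qed

end
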